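(* Let $r\geq 1$ and $k\geq 2$ be integers, and let $\ell_0=\left\lceil \max\left\{\sqrt{\tfrac{k}{2}+1},\ \tfrac{k-1}{r}+2\right\}\right\rceil$. Then for every integer $\ell\geq \ell_0$, $rc_k(K_{\ell^2[r]})=2$.
   Context: For integers $m\geq 1$ and $r\geq 1$, $K_{m[r]}$ denotes the complete $m$-partite graph in which each of the $m$ parts has exactly $r$ vertices. In an edge-colored graph (adjacent edges may receive the same color), a path is rainbow if no two of its edges have the same color. For a $\kappa$-connected graph $G$ and an integer $k$ with $1\leq k\leq\kappa$, the rainbow $k$-connectivity $rc_k(G)$ is the minimum integer $j$ such that there is an edge-coloring of $G$ with $j$ colors in which every two distinct vertices $u,v$ are connected by at least $k$ internally disjoint rainbow $u$–$v$ paths. *)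

theory Defs
  imports Complex_Main "HOL-Library.Extended_Nat"
begin

text \<open>An edge is the two-element set of its end vertices; the type itself does not enforce this.\<close>

type_synonym 'a ugraph = "'a set \<times> 'a set set"

abbreviation verts :: "'a ugraph \<Rightarrow> 'a set" where
  "verts G \<equiv> fst G"

abbreviation edges :: "'a ugraph \<Rightarrow> 'a set set" where
  "edges G \<equiv> snd G"

text \<open>Vertex \<open>(i, a)\<close> is the \<open>a\<close>-th vertex of the \<open>i\<close>-th of the \<open>m\<close> parts.\<close>

definition complete_multipartite :: "nat \<Rightarrow> nat \<Rightarrow> (nat \<times> nat) ugraph" where
  "complete_multipartite m r =
    ({..<m} \<times> {..<r},
     {{u, v} | u v. u \<in> {..<m} \<times> {..<r} \<and> v \<in> {..<m} \<times> {..<r} \<and> fst u \<noteq> fst v})"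

definition path_edges :: "'a list \<Rightarrow> 'a set list" where
  "path_edges p = map2 (\<lambda>x y. {x, y}) p (tl p)"

definition is_path :: "'a ugraph \<Rightarrow> 'a \<Rightarrow> 'a \<Rightarrow> 'a list \<Rightarrow> bool" where
  "is_path G u v p \<longleftrightarrow>
    p \<noteq> [] \<and> hd p = u \<and> last p = v \<and> distinct p \<and>
    set p \<subseteq> verts G \<and> set (path_edges p) \<subseteq> edges G"

definition rainbow :: "('a set \<Rightarrow> nat) \<Rightarrow> 'a list \<Rightarrow> bool" where
  "rainbow c p \<longleftrightarrow> distinct (map c (path_edges p))"

definition interior_verts :: "'a list \<Rightarrow> 'a set" where
  "interior_verts p = set (butlast (tl p))"

definition internally_disjoint :: "'a list set \<Rightarrow> bool" where
  "internally_disjoint P \<longleftrightarrow>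
    (\<forall>p\<in>P. \<forall>q\<in>P. p \<noteq> q \<longrightarrow> interior_verts p \<inter> interior_verts q = {})"

definition rainbow_k_connected :: "nat \<Rightarrow> 'a ugraph \<Rightarrow> ('a set \<Rightarrow> nat) \<Rightarrow> bool" where
  "rainbow_k_connected k G c \<longleftrightarrow>
    (\<forall>u\<in>verts G. \<forall>v\<in>verts G. u \<noteq> v \<longrightarrow>
      (\<exists>P. finite P \<and> card P \<ge> k \<and> internally_disjoint P \<and>
           (\<forall>p\<in>P. is_path G u v p \<and> rainbow c p)))"

definition rainbow_k_colorable :: "nat \<Rightarrow> 'a ugraph \<Rightarrow> nat \<Rightarrow> bool" where
  "rainbow_k_colorable k G j \<longleftrightarrow>
    (\<exists>c. c ` edges G \<subseteq> {..<j} \<and> rainbow_k_connected k G c)"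

text \<open>
  The minimum is taken in \<^typ>\<open>enat\<close>, so that it is \<open>\<infinity>\<close> when no suitable coloring exists
  (that is, when \<open>k\<close> exceeds the connectivity). A finite value is attained:
  see \<open>rc_eq_enat_iff\<close>.
\<close>

definition rc :: "nat \<Rightarrow> 'a ugraph \<Rightarrow> enat" where
  "rc k G = (INF j \<in> {j. rainbow_k_colorable k G j}. enat j)"

lemma rc_eq_enat_iff:
  "rc k G = enat n \<longleftrightarrow>
    rainbow_k_colorable k G n \<and> (\<forall>j<n. \<not> rainbow_k_colorable k G j)"
proof (cases "\<exists>j. rainbow_k_colorable k G j")
  case True
  define m where "m = (LEAST j. rainbow_k_colorable k G j)"
  have m: "rainbow_k_colorable k G m"
    unfolding m_def using True by (rule LeastI_ex)
  have least: "m \<le> j" if "rainbow_k_colorable k G j" for j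
    unfolding m_def using that by (rule Least_le)
  have "rc k G = enat m"
    unfolding rc_def
    by (rule antisym) (auto intro!: INF_lower INF_greatest simp: m least)
  then show ?thesis
    using m least by (metis enat.inject le_antisym not_le)
next
  case False
  then show ?thesis
    by (simp add: rc_def top_enat_def)
qed

end

theory Submission
  imports Defs
begin

text \<open>
  Place the \<open>l\<^sup>2\<close> parts on an \<open>l \<times> l\<close> board. Between two parts, the edges joining
  vertices with equal index get one color and all other edges the other color; which color is
  which depends on whether the two parts share a line (row or column) of the board. Two vertices
  \<open>(p, a)\<close>, \<open>(p, b)\<close> of one part are then joined by the rainbow paths through \<open>(s, a)\<close> and
  \<open>(s, b)\<close> for all \<open>s \<noteq> p\<close>, which are \<open>2(l\<^sup>2 - 1) \<ge> k\<close> many. For \<open>(p, a)\<close>, \<open>(q, b)\<close> in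
  different parts, call \<open>s\<close> separating if it shares a line with exactly one of \<open>p\<close>, \<open>q\<close>.
  If \<open>a = b\<close>, every vertex of a separating part is the middle of a rainbow path. Otherwise a
  separating part contributes its \<open>r - 2\<close> vertices with index outside \<open>{a, b}\<close>, and a
  non-separating one the two vertices with index in \<open>{a, b}\<close>. There are at least \<open>l - 2\<close> parts
  of each kind, so together with the edge this gives \<open>r(l - 2) + 1 \<ge> k\<close> paths.
\<close>

section \<open>Lines of the board and the two-coloring of the edges\<close>

definition collinear :: "nat \<Rightarrow> nat \<Rightarrow> nat \<Rightarrow> bool" where
  "collinear l i j \<longleftrightarrow> i div l = j div l \<or> i mod l = j mod l"

definition board_pred :: "nat \<Rightarrow> nat \<times> nat \<Rightarrow> nat \<times> nat \<Rightarrow> bool" where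
  "board_pred l u v \<longleftrightarrow> (snd u = snd v) \<noteq> collinear l (fst u) (fst v)"

text \<open>An edge is an unordered pair, hence the existential over its orientations; as
  \<open>board_pred\<close> is symmetric, either orientation gives the same color.\<close>

definition board_coloring :: "nat \<Rightarrow> (nat \<times> nat) set \<Rightarrow> nat" where
  "board_coloring l e = of_bool (\<exists>u v. e = {u, v} \<and> board_pred l u v)"

lemma board_pred_sym: "board_pred l u v \<longleftrightarrow> board_pred l v u"
  by (auto simp: board_pred_def collinear_def)

lemma board_coloring_edge: "board_coloring l {u, v} = of_bool (board_pred l u v)"
proof -
  have "(\<exists>u' v'. {u, v} = {u', v'} \<and> board_pred l u' v') \<longleftrightarrow> board_pred l u v"
    unfolding doubleton_eq_iff using board_pred_sym[of l u v] by blast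
  then show ?thesis by (simp only: board_coloring_def)
qed

lemma board_coloring_range: "board_coloring l ` S \<subseteq> {..<2}"
  by (auto simp: board_coloring_def)

section \<open>Cells of the board and separating parts\<close>

lemma cell_index:
  fixes x y l :: nat
  assumes "x < l" "y < l"
  shows "x * l + y < l\<^sup>2" "(x * l + y) div l = x" "(x * l + y) mod l = y"
proof -
  have "x * l + y < Suc x * l" using assms by simp
  also have "\<dots> \<le> l * l" using assms by (intro mult_right_mono) auto
  finally show "x * l + y < l\<^sup>2" by (simp add: power2_eq_square)
qed (use assms in auto)

lemma card_lessThan_diff_two: "l - 2 \<le> card ({..<l} - {a, b :: nat})"
proof -
  have "card {..<l} - card {a, b} \<le> card ({..<l} - {a, b})"
    by (rule diff_card_le_card_Diff) simp
  moreover have "card {a, b} \<le> 2" by (simp add: card_insert_if)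
  ultimately show ?thesis by simp
qed

lemma card_row_part:
  assumes "x < l"
  shows "l - 2 \<le> card ((\<lambda>y. x * l + y) ` ({..<l} - {a, b :: nat}))"
  using card_lessThan_diff_two[of l a b] by (subst card_image) (auto simp: inj_on_def)

lemma card_column_part:
  assumes "y < l"
  shows "l - 2 \<le> card ((\<lambda>x. x * l + y) ` ({..<l} - {a, b :: nat}))"
  using card_lessThan_diff_two[of l a b] assms
  by (subst card_image) (auto simp: inj_on_def)

text \<open>If \<open>p\<close> and \<open>q\<close> lie on a common line, the rest of that line
  meets both, and the perpendicular line through \<open>p\<close> meets only \<open>p\<close>.
  Otherwise the row of \<open>p\<close>, without the columns of \<open>p\<close> and
  \<open>q\<close>, is collinear with \<open>p\<close> alone, and a third row without these columns
  is collinear with neither; such a row exists because \<open>l \<ge> 3\<close>.\<close>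

lemma separating_parts:
  fixes p q l :: nat
  assumes l: "l \<ge> 3" and p: "p < l\<^sup>2" and q: "q < l\<^sup>2" and "p \<noteq> q"
  obtains D E where
    "D \<subseteq> {..<l\<^sup>2} - {p, q}" "E \<subseteq> {..<l\<^sup>2} - {p, q}"
    "l - 2 \<le> card D" "l - 2 \<le> card E"
    "\<And>s. s \<in> D \<Longrightarrow> collinear l p s \<noteq> collinear l q s"
    "\<And>s. s \<in> E \<Longrightarrow> collinear l p s = collinear l q s"
proof -
  define x y x' y' where "x = p div l" and "y = p mod l" and "x' = q div l" and "y' = q mod l"
  have bounds: "x < l" "y < l" "x' < l" "y' < l"
    using l p q by (auto simp: x_def y_def x'_def y'_def power2_eq_square less_mult_imp_div_less)
  have ne: "x \<noteq> x' \<or> y \<noteq> y'"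
    using \<open>p \<noteq> q\<close> unfolding x_def y_def x'_def y'_def by (metis div_mult_mod_eq)
  have col: "collinear l p (i * l + j) \<longleftrightarrow> x = i \<or> y = j"
    "collinear l q (i * l + j) \<longleftrightarrow> x' = i \<or> y' = j" if "i < l" "j < l" for i j
    using that by (simp_all add: collinear_def x_def y_def x'_def y'_def cell_index)
  have cell: "i * l + j = p \<longleftrightarrow> i = x \<and> j = y" "i * l + j = q \<longleftrightarrow> i = x' \<and> j = y'"
    if "i < l" "j < l" for i j
    using that cell_index(2,3)[OF that] unfolding x_def y_def x'_def y'_def
    by (metis div_mult_mod_eq)+
  note facts = bounds cell_index(1) col cell image_subset_iff
  consider "x = x'" "y \<noteq> y'" | "x \<noteq> x'" "y = y'" | "x \<noteq> x'" "y \<noteq> y'"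
    using ne by blast
  then show thesis
  proof cases
    case 1
    show thesis
      by (rule that[OF _ _ card_column_part[of y l x x'] card_row_part[of x l y y']])
        (use 1 in \<open>auto simp: facts\<close>)
  next
    case 2
    show thesis
      by (rule that[OF _ _ card_row_part[of x l y y'] card_column_part[of y l x x']])
        (use 2 in \<open>auto simp: facts\<close>)
  next
    case 3
    have "{..<l} - {x, x'} \<noteq> {}"
    proof
      assume "{..<l} - {x, x'} = {}"
      then show False using card_lessThan_diff_two[of l x x'] l
        by (simp only: card.empty)
    qed
    then obtain z where z: "z < l" "z \<noteq> x" "z \<noteq> x'" by auto
    show thesis
      by (rule that[OF _ _ card_row_part[of x l y y'] card_row_part[of z l y y']])
        (use 3 z in \<open>auto simp: facts\<close>)
  qed
qed

section \<open>Rainbow paths with one middle vertex\<close>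

lemma two_path:
  assumes "{u, w} \<in> edges G" "{w, v} \<in> edges G" "{u, w, v} \<subseteq> verts G"
    and "distinct [u, w, v]" and "c {u, w} \<noteq> c {w, v}"
  shows "is_path G u v [u, w, v]" "rainbow c [u, w, v]"
  using assms by (auto simp: is_path_def rainbow_def path_edges_def)

lemma internally_disjoint_two_paths: "internally_disjoint ((\<lambda>w. [u, w, v]) ` W)"
  by (auto simp: internally_disjoint_def interior_verts_def)

lemma internally_disjoint_two_paths_edge:
  "internally_disjoint (insert [u, v] ((\<lambda>w. [u, w, v]) ` W))"
  by (auto simp: internally_disjoint_def interior_verts_def)

lemma card_two_paths: "card ((\<lambda>w. [u, w, v]) ` W) = card W"
  by (intro card_image) (auto simp: inj_on_def)

lemma complete_multipartite_edge:
  "{u, v} \<in> edges (complete_multipartite m r) \<longleftrightarrow>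
    u \<in> {..<m} \<times> {..<r} \<and> v \<in> {..<m} \<times> {..<r} \<and> fst u \<noteq> fst v"
  by (force simp: complete_multipartite_def doubleton_eq_iff)

lemma board_two_path:
  assumes "u \<in> {..<m} \<times> {..<r}" "v \<in> {..<m} \<times> {..<r}" "w \<in> {..<m} \<times> {..<r}"
    and "u \<noteq> v" "fst w \<noteq> fst u" "fst w \<noteq> fst v" "board_pred l u w \<noteq> board_pred l v w"
  shows "is_path (complete_multipartite m r) u v [u, w, v]
    \<and> rainbow (board_coloring l) [u, w, v]"
proof -
  have "{u, w} \<in> edges (complete_multipartite m r)" "{w, v} \<in> edges (complete_multipartite m r)"
    using assms by (simp_all add: complete_multipartite_edge)
  moreover have "{u, w, v} \<subseteq> verts (complete_multipartite m r)"
    using assms by (simp add: complete_multipartite_def)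
  moreover have "distinct [u, w, v]" using assms by auto
  moreover have "board_coloring l {u, w} \<noteq> board_coloring l {w, v}"
    using assms(7) board_pred_sym[of l v w] by (auto simp: board_coloring_edge)
  ultimately show ?thesis by (intro conjI two_path)
qed

section \<open>Families of disjoint rainbow paths\<close>

lemma board_paths_same_part:
  fixes p a b l r k :: nat
  assumes "p < l\<^sup>2" "a < r" "b < r" "a \<noteq> b" and k: "k \<le> 2 * (l\<^sup>2 - 1)"
  shows "\<exists>P. finite P \<and> card P \<ge> k \<and> internally_disjoint P \<and>
    (\<forall>\<pi>\<in>P. is_path (complete_multipartite (l\<^sup>2) r) (p, a) (p, b) \<pi>
      \<and> rainbow (board_coloring l) \<pi>)"
proof -
  \<comment> \<open>Both ends are in part \<open>p\<close>, so collinearity with the middle agrees,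
    while its index equals exactly one of \<open>a\<close> and \<open>b\<close>: the two colors
    differ.\<close>
  define W where "W = ({..<l\<^sup>2} - {p}) \<times> {a, b}"
  have W: "card W = 2 * (l\<^sup>2 - 1)" "finite W"
    using assms by (auto simp: W_def card_cartesian_product)
  have "is_path (complete_multipartite (l\<^sup>2) r) (p, a) (p, b) [(p, a), w, (p, b)]
      \<and> rainbow (board_coloring l) [(p, a), w, (p, b)]" if "w \<in> W" for w
    using that assms by (intro board_two_path) (auto simp: W_def board_pred_def)
  then show ?thesis
    using W k
    by (intro exI[of _ "(\<lambda>w. [(p, a), w, (p, b)]) ` W"])
      (auto simp: card_two_paths internally_disjoint_two_paths)
qed

lemma board_midpoints:
  fixes p q a b l r :: nat
  assumes l: "l \<ge> 3" and pq: "p < l\<^sup>2" "q < l\<^sup>2" "p \<noteq> q" and ab: "a < r" "b < r"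
  obtains W where "W \<subseteq> ({..<l\<^sup>2} - {p, q}) \<times> {..<r}" "r * (l - 2) \<le> card W"
    "\<And>w. w \<in> W \<Longrightarrow> board_pred l (p, a) w \<noteq> board_pred l (q, b) w"
proof -
  obtain D E where DE:
    "D \<subseteq> {..<l\<^sup>2} - {p, q}" "E \<subseteq> {..<l\<^sup>2} - {p, q}"
    "l - 2 \<le> card D" "l - 2 \<le> card E"
    "\<And>s. s \<in> D \<Longrightarrow> collinear l p s \<noteq> collinear l q s"
    "\<And>s. s \<in> E \<Longrightarrow> collinear l p s = collinear l q s"
    by (rule separating_parts[OF l pq]) (rule that)
  show thesis
  proof (cases "a = b")
    case True
    have "r * (l - 2) \<le> card (D \<times> {..<r})"
      using DE(3) by (simp add: card_cartesian_product mult.commute)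
    then show thesis
      using DE True by (intro that[of "D \<times> {..<r}"]) (auto simp: board_pred_def)
  next
    case False
    \<comment> \<open>With an index outside \<open>{a, b}\<close> both colors depend on collinearity
      alone and differ for separating parts. With index \<open>a\<close> or \<open>b\<close> exactly
      one of the two is flipped, so they differ for the other parts.\<close>
    let ?W = "D \<times> ({..<r} - {a, b}) \<union> E \<times> {a, b}"
    have fin: "finite D" "finite E" using finite_subset[OF DE(1)] finite_subset[OF DE(2)] by simp_all
    have "card ({..<r} - {a, b}) = r - 2"
      using ab False by (subst card_Diff_subset) auto
    then have "card ?W = card D * (r - 2) + card E * 2"
      using fin False by (subst card_Un_disjoint) (auto simp: card_cartesian_product)
    \<comment> \<open>Two distinct indices below \<open>r\<close> force \<open>r \<ge> 2\<close>, so
      the truncated \<open>r - 2\<close> loses nothing.\<close>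
    moreover have "r * (l - 2) = (l - 2) * (r - 2) + (l - 2) * 2"
    proof -
      have "r - 2 + 2 = r" using ab False by linarith
      then show ?thesis by (simp only: mult.commute[of r] flip: distrib_left)
    qed
    ultimately have "r * (l - 2) \<le> card ?W"
      using DE(3,4) by (simp only: add_mono mult_le_mono1)
    then show thesis
      using DE False ab by (intro that[of ?W]) (auto simp: board_pred_def)
  qed
qed

lemma board_paths_distinct_parts:
  fixes p q a b l r k :: nat
  assumes "l \<ge> 3" "p < l\<^sup>2" "q < l\<^sup>2" "p \<noteq> q" "a < r" "b < r"
    and k: "k \<le> r * (l - 2) + 1"
  shows "\<exists>P. finite P \<and> card P \<ge> k \<and> internally_disjoint P \<and>
    (\<forall>\<pi>\<in>P. is_path (complete_multipartite (l\<^sup>2) r) (p, a) (q, b) \<pi>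
      \<and> rainbow (board_coloring l) \<pi>)"
proof -
  obtain W where W: "W \<subseteq> ({..<l\<^sup>2} - {p, q}) \<times> {..<r}" "r * (l - 2) \<le> card W"
    "\<And>w. w \<in> W \<Longrightarrow> board_pred l (p, a) w \<noteq> board_pred l (q, b) w"
    by (rule board_midpoints[OF assms(1-6)]) (rule that)
  have "finite W" using W(1) by (rule finite_subset) simp
  \<comment> \<open>The direct edge is trivially rainbow and has no interior; it supplies the
    summand 1 in the bound on \<open>k\<close>.\<close>
  define P where "P = insert [(p, a), (q, b)] ((\<lambda>w. [(p, a), w, (q, b)]) ` W)"
  have "card P = Suc (card W)"
    using \<open>finite W\<close> unfolding P_def
    by (subst card_insert_disjoint) (auto simp: card_two_paths)
  moreover have "is_path (complete_multipartite (l\<^sup>2) r) (p, a) (q, b) [(p, a), w, (q, b)]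
      \<and> rainbow (board_coloring l) [(p, a), w, (q, b)]" if "w \<in> W" for w
    using that assms W(1) W(3)[OF that] by (intro board_two_path) auto
  moreover have "is_path (complete_multipartite (l\<^sup>2) r) (p, a) (q, b) [(p, a), (q, b)]
      \<and> rainbow (board_coloring l) [(p, a), (q, b)]"
    using assms complete_multipartite_edge[of "(p, a)" "(q, b)" "l\<^sup>2" r]
    by (auto simp: is_path_def rainbow_def path_edges_def complete_multipartite_def)
  ultimately show ?thesis
    using W(2) k \<open>finite W\<close>
    by (intro exI[of _ P]) (auto simp: P_def internally_disjoint_two_paths_edge)
qed

section \<open>Fewer than two colors do not suffice\<close>

lemma rainbow_path_single_color:
  assumes "is_path G u v p" "rainbow c p" "c ` edges G \<subseteq> {..<j}" "j < 2" "u \<noteq> v"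
  shows "p = [u, v]"
proof -
  \<comment> \<open>Only color \<open>0\<close> is available, and the colors along the path are
    distinct, so it has at most one edge.\<close>
  have "set (map c (path_edges p)) \<subseteq> {0}"
    using assms by (force simp: is_path_def)
  then have "card (set (map c (path_edges p))) \<le> card {0 :: nat}"
    by (intro card_mono) auto
  moreover have "card (set (map c (path_edges p))) = length p - 1"
    using assms(2) by (subst distinct_card) (auto simp: rainbow_def path_edges_def)
  ultimately have "length p \<le> 2" by simp
  then show ?thesis
    using assms(1,5) by (cases p; cases "tl p") (auto simp: is_path_def)
qed

lemma single_color_not_rainbow_k_connected:
  assumes "u \<in> verts G" "v \<in> verts G" "u \<noteq> v" "k \<ge> 2" "j < 2"
  shows "\<not> rainbow_k_colorable k G j"
proof
  assume "rainbow_k_colorable k G j"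
  then obtain c P where c: "c ` edges G \<subseteq> {..<j}"
    and P: "card P \<ge> k" "\<forall>p\<in>P. is_path G u v p \<and> rainbow c p"
    using assms unfolding rainbow_k_colorable_def rainbow_k_connected_def by meson
  have "P \<subseteq> {[u, v]}"
    using rainbow_path_single_color[OF _ _ c assms(5,3)] P(2) by blast
  then have "card P \<le> card {[u, v]}" by (intro card_mono) auto
  then show False using P(1) assms(4) by simp
qed

theorem theorem2:
  fixes r k l :: nat
  assumes "r \<ge> 1" and "k \<ge> 2"
    and "int l \<ge> \<lceil>max (sqrt (real k / 2 + 1)) ((real k - 1) / real r + 2)\<rceil>"
  shows "rc k (complete_multipartite (l\<^sup>2) r) = 2"
proof -
  have sqrt_le: "sqrt (real k / 2 + 1) \<le> real l" and frac_le: "(real k - 1) / real r + 2 \<le> real l"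
    using assms(3) by (simp_all add: ceiling_le_iff)
  \<comment> \<open>Squaring the root bound serves pairs within one part; the fraction bound,
    cleared of its denominator, serves pairs in different parts.\<close>
  have "real k / 2 + 1 \<le> (real l)\<^sup>2"
    using sqrt_le by (rule sqrt_le_D)
  then have "real (k + 2) \<le> real (2 * l\<^sup>2)" by simp
  then have k_same: "k \<le> 2 * (l\<^sup>2 - 1)" unfolding of_nat_le_iff by simp
  \<comment> \<open>As \<open>k \<ge> 2\<close>, the fraction is positive and \<open>l\<close>
    exceeds 2, so \<open>l - 2\<close> on naturals agrees with the real difference.\<close>
  have "(real k - 1) / real r > 0" using assms(1,2) by simp
  then have l: "l \<ge> 3" using frac_le by linarith
  have "real k - 1 \<le> (real l - 2) * real r"
    using frac_le assms(1) by (simp add: pos_divide_le_eq flip: le_diff_eq)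
  also have "\<dots> = real (r * (l - 2))" using l by simp
  finally have k_diff: "k \<le> r * (l - 2) + 1" by linarith
  have "rainbow_k_connected k (complete_multipartite (l\<^sup>2) r) (board_coloring l)"
    unfolding rainbow_k_connected_def
  proof (intro ballI impI)
    fix u v
    assume uv: "u \<in> verts (complete_multipartite (l\<^sup>2) r)"
      "v \<in> verts (complete_multipartite (l\<^sup>2) r)" "u \<noteq> v"
    obtain p a q b where eq: "u = (p, a)" "v = (q, b)" by (metis surj_pair)
    have bounds: "p < l\<^sup>2" "q < l\<^sup>2" "a < r" "b < r"
      using uv by (auto simp: eq complete_multipartite_def)
    show "\<exists>P. finite P \<and> card P \<ge> k \<and> internally_disjoint P \<and>
      (\<forall>\<pi>\<in>P. is_path (complete_multipartite (l\<^sup>2) r) u v \<pi> \<and> rainbow (board_coloring l) \<pi>)"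
    proof (cases "p = q")
      case True
      then show ?thesis
        using board_paths_same_part[of p l a r b k] bounds uv(3) k_same by (simp add: eq)
    next
      case False
      then show ?thesis
        using board_paths_distinct_parts[of l p q a r b k] bounds l k_diff by (simp add: eq)
    qed
  qed
  then have "rainbow_k_colorable k (complete_multipartite (l\<^sup>2) r) 2"
    unfolding rainbow_k_colorable_def using board_coloring_range by blast
  moreover have "\<not> rainbow_k_colorable k (complete_multipartite (l\<^sup>2) r) j" if "j < 2" for j
  proof (rule single_color_not_rainbow_k_connected[OF _ _ _ assms(2) that])
    \<comment> \<open>A second part guarantees two distinct vertices even when
      \<open>r = 1\<close>.\<close>
    have "1 < l\<^sup>2" using l by (intro one_less_power) auto
    then show "(0, 0) \<in> verts (complete_multipartite (l\<^sup>2) r)"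
      "(1, 0) \<in> verts (complete_multipartite (l\<^sup>2) r)"
      using assms(1) l by (auto simp: complete_multipartite_def)
  qed simp
  ultimately have "rc k (complete_multipartite (l\<^sup>2) r) = enat 2"
    by (simp add: rc_eq_enat_iff)
  then show ?thesis by (simp add: numeral_eq_enat)
qed

end
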